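(* Let $\mathbf{y}=(y_1,y_2)\in\mathbb{N}^2$. Then $\mathbf{y}$ is minimally invariant if and only if $y_1<y_2$.
   Context: $\mathbb{N}=\{1,2,3,\ldots\}$ and $[k]=\{1,\ldots,k\}$. Let $\mathbf{y}=(y_1,\ldots,y_n)\in\mathbb{N}^n$ be car lengths and $m=\sum_{i=1}^n y_i$. A one-way street has spots $1,\ldots,m$, initially empty. Given preferences $\mathbf{x}=(x_1,\ldots,x_n)\in[m]^n$, cars $1,\ldots,n$ enter in this order; car $i$ parks in spots $j,j+1,\ldots,j+y_i-1$, where $j\ge x_i$ is the smallest integer such that $j+y_i-1\le m$ and all these spots are unoccupied; if no such $j$ exists, parking fails. If all cars park, $\mathbf{x}$ is a parking assortment for $\mathbf{y}$; $\mathsf{PA}_n(\mathbf{y})$ is the set of these. $\mathsf{PA}^{\mathrm{inv}}_n(\mathbf{y})$ is the set of (permutation) invariant parking assortments: those $\mathbf{x}\in\mathsf{PA}_n(\mathbf{y})$ all of whose rearrangements are also in $\mathsf{PA}_n(\mathbf{y})$ (with $\mathbf{y}$ fixed). A list $\mathbf{y}\in\mathbb{N}^n$ is called minimally invariant if $\mathsf{PA}^{\mathrm{inv}}_n(\mathbf{y})=\{(1^n)\}$, where $(1^n)$ is the list of $n$ ones. *)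

theory Defs
  imports "HOL-Library.Multiset"
begin

text \<open>
  Car lengths and preferences are lists of positive naturals (positivity of the lengths is an
  explicit hypothesis where it is needed); spots are the numbers \<open>1, \<dots>, m\<close>.
\<close>

definition can_park_at :: "nat \<Rightarrow> nat set \<Rightarrow> nat \<Rightarrow> nat \<Rightarrow> nat \<Rightarrow> bool" where
  "can_park_at m Occ x y j \<longleftrightarrow> j \<ge> x \<and> j + y - 1 \<le> m \<and> {j..j + y - 1} \<inter> Occ = {}"

text \<open>
  \<open>all_park m Occ xs ys\<close>: on a street of \<open>m\<close> spots with \<open>Occ\<close> already occupied, the cars with
  preferences \<open>xs\<close> and lengths \<open>ys\<close>, entering in list order, all manage to park.
\<close>

fun all_park :: "nat \<Rightarrow> nat set \<Rightarrow> nat list \<Rightarrow> nat list \<Rightarrow> bool" where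
  "all_park m Occ [] [] \<longleftrightarrow> True"
| "all_park m Occ (x # xs) (y # ys) \<longleftrightarrow>
     (\<exists>j. can_park_at m Occ x y j) \<and>
     (let j = (LEAST j. can_park_at m Occ x y j)
      in all_park m (Occ \<union> {j..j + y - 1}) xs ys)"
| "all_park m Occ _ _ \<longleftrightarrow> False"

definition PA :: "nat list \<Rightarrow> nat list set" where
  "PA ys = {xs. length xs = length ys \<and> set xs \<subseteq> {1..sum_list ys} \<and>
                all_park (sum_list ys) {} xs ys}"

definition PA_inv :: "nat list \<Rightarrow> nat list set" where
  "PA_inv ys = {xs \<in> PA ys. \<forall>xs'. mset xs' = mset xs \<longrightarrow> xs' \<in> PA ys}"

definition minimally_invariant :: "nat list \<Rightarrow> bool" where
  "minimally_invariant ys \<longleftrightarrow> PA_inv ys = {replicate (length ys) 1}"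

end

theory Submission
  imports Defs
begin

text \<open>
  If the first car does not start at spot 1, the gap in front of it is shorter than \<open>y2\<close> unless it
  starts at \<open>y2 + 1\<close>, and the gap behind it is always too short. Hence the parking assortments are
  \<open>(1, b)\<close> with \<open>b \<le> y1 + 1\<close> together with \<open>(y2 + 1, 1)\<close>. The only nonconstant candidate for
  invariance is therefore \<open>(1, y2 + 1)\<close>, which parks exactly when \<open>y2 \<le> y1\<close>.
\<close>

lemma Least_can_park_at_empty:
  assumes "x + y \<le> m + 1"
  shows "(LEAST j. can_park_at m {} x y j) = x"
  using assms by (intro Least_equality) (auto simp: can_park_at_def)

lemma ex_can_park_at_empty_iff:
  "(\<exists>j. can_park_at m {} x y j) \<longleftrightarrow> x + y \<le> m + 1"
proof
  assume "\<exists>j. can_park_at m {} x y j"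
  then show "x + y \<le> m + 1" by (auto simp: can_park_at_def)
next
  assume "x + y \<le> m + 1"
  then have "can_park_at m {} x y x" by (auto simp: can_park_at_def)
  then show "\<exists>j. can_park_at m {} x y j" ..
qed

lemma interval_disjoint_iff:
  fixes a b c d :: "'a :: linorder"
  assumes "a \<le> b" and "c \<le> d"
  shows "{a..b} \<inter> {c..d} = {} \<longleftrightarrow> b < c \<or> d < a"
  using assms by (auto simp: Int_atLeastAtMost)

text \<open>Car 1 leaves exactly \<open>y2\<close> spots free, so car 2 fits only if they are
  contiguous, that is, if car 1 stands flush with one end of the street.\<close>

lemma ex_can_park_at_second_iff:
  assumes "y1 \<ge> 1" and "y2 \<ge> 1" and "a \<ge> 1" and "b \<ge> 1" and "a \<le> y2 + 1"
  shows "(\<exists>j. can_park_at (y1 + y2) {a..a + y1 - 1} b y2 j) \<longleftrightarrow>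
         a = 1 \<and> b \<le> y1 + 1 \<or> a = y2 + 1 \<and> b = 1"
    (is "(\<exists>j. ?P j) \<longleftrightarrow> ?R")
proof -
  have P: "?P j \<longleftrightarrow> b \<le> j \<and> j \<le> y1 + 1 \<and> (j + y2 \<le> a \<or> a + y1 \<le> j)" for j
  proof -
    \<comment> \<open>Positive lengths make both blocks nonempty and keep \<open>- 1\<close> from
      truncating.\<close>
    have "{j..j + y2 - 1} \<inter> {a..a + y1 - 1} = {} \<longleftrightarrow> j + y2 - 1 < a \<or> a + y1 - 1 < j"
      using assms by (intro interval_disjoint_iff) auto
    then show ?thesis
      using assms unfolding can_park_at_def by linarith
  qed
  show ?thesis
  proof
    assume "\<exists>j. ?P j"
    then obtain j where "b \<le> j \<and> j \<le> y1 + 1 \<and> (j + y2 \<le> a \<or> a + y1 \<le> j)"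
      unfolding P by blast
    then show ?R using assms by linarith
  next
    assume ?R
    \<comment> \<open>Start \<open>b\<close> = 1 serves a car 1 at the far end;
      \<open>y1 + 1\<close> is the first spot behind a car 1 at the near end.\<close>
    then have "?P b \<or> ?P (y1 + 1)" unfolding P using assms by auto
    then show "\<exists>j. ?P j" by blast
  qed
qed

lemma mem_PA_pair_iff:
  assumes "y1 \<ge> 1" and "y2 \<ge> 1"
  shows "[a, b] \<in> PA [y1, y2] \<longleftrightarrow>
         a = 1 \<and> 1 \<le> b \<and> b \<le> y1 + 1 \<or> a = y2 + 1 \<and> b = 1"
\<comment> \<open>The bound \<open>a \<le> y2 + 1\<close> says that car 1 fits on the empty street,
  where it parks exactly at \<open>a\<close>.\<close>
proof (cases "1 \<le> a \<and> a \<le> y2 + 1 \<and> 1 \<le> b")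
  case True
  then have "a + y1 \<le> y1 + y2 + 1" by simp
  then have "[a, b] \<in> PA [y1, y2] \<longleftrightarrow> a \<le> y1 + y2 \<and> b \<le> y1 + y2 \<and>
               (\<exists>j. can_park_at (y1 + y2) {a..a + y1 - 1} b y2 j)"
    using True by (simp add: PA_def Let_def Least_can_park_at_empty ex_can_park_at_empty_iff)
  also have "\<dots> \<longleftrightarrow> a \<le> y1 + y2 \<and> b \<le> y1 + y2 \<and>
               (a = 1 \<and> b \<le> y1 + 1 \<or> a = y2 + 1 \<and> b = 1)"
    using True assms ex_can_park_at_second_iff by simp
  \<comment> \<open>The bounds by \<open>y1 + y2\<close> follow from the others because both lengths
    are positive.\<close>
  finally show ?thesis using True assms by auto
next
  case False
  then show ?thesis
    by (auto simp: PA_def ex_can_park_at_empty_iff)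
qed

lemma mset_eq_pair_iff:
  "mset xs = {#a, b#} \<longleftrightarrow> xs = [a, b] \<or> xs = [b, a]"
proof
  assume *: "mset xs = {#a, b#}"
  then have "length xs = 2" by (metis size_mset size_add_mset size_empty numeral_2_eq_2)
  then obtain c d where "xs = [c, d]" by (auto simp: length_Suc_conv numeral_2_eq_2)
  with * show "xs = [a, b] \<or> xs = [b, a]" by (auto simp: add_eq_conv_ex)
qed auto

lemma mem_PA_inv_pair_iff:
  "[a, b] \<in> PA_inv ys \<longleftrightarrow> [a, b] \<in> PA ys \<and> [b, a] \<in> PA ys"
  by (auto simp: PA_inv_def mset_eq_pair_iff)

lemma PA_inv_pair:
  assumes "y1 \<ge> 1" and "y2 \<ge> 1"
  shows "PA_inv [y1, y2] =
         (if y1 < y2 then {[1, 1]} else {[1, 1], [1, y2 + 1], [y2 + 1, 1]})"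
    (is "_ = ?S")
proof (rule set_eqI)
  fix xs
  show "xs \<in> PA_inv [y1, y2] \<longleftrightarrow> xs \<in> ?S"
  proof (cases "length xs = 2")
    case True
    then obtain a b where "xs = [a, b]" by (auto simp: length_Suc_conv numeral_2_eq_2)
    then show ?thesis
      using assms by (auto simp: mem_PA_inv_pair_iff mem_PA_pair_iff)
  next
    case False
    then show ?thesis by (auto simp: PA_inv_def PA_def)
  qed
qed

theorem corollary5p2:
  fixes y1 y2 :: nat
  assumes "y1 \<ge> 1" and "y2 \<ge> 1"
  shows "minimally_invariant [y1, y2] \<longleftrightarrow> y1 < y2"
  \<comment> \<open>If \<open>y2 \<le> y1\<close>, the witness \<open>[1, y2 + 1]\<close> differs
    from \<open>[1, 1]\<close> since \<open>y2 \<ge> 1\<close>.\<close>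
  using assms by (auto simp: minimally_invariant_def PA_inv_pair)

end
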